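(* For every integer $n\ge 0$ and every complex number $t\neq -1$, $$\sum_{k=0}^{n}\boldsymbol{l}(n,k)\,t^{k}=\frac{1}{1+t}\sum_{j=0}^{n}(-1)^{j}\frac{D_{j}}{j!}\left(\frac{t}{1+t}\right)^{n-j}\left(1+t^{\,j+1}\right).$$
   Context: The Leibnitz numbers are defined for integers $n\ge 0$ and $0\le k\le n$ by $\boldsymbol{l}(n,k)=\dfrac{1}{(n+1)\binom{n}{k}}$. The Daehee numbers $D_n$ ($n\ge 0$) are defined by $\dfrac{\log(1+u)}{u}=\sum_{n=0}^{\infty}D_n\dfrac{u^n}{n!}$; explicitly $D_n=(-1)^n\dfrac{n!}{n+1}$. The convention $0^0=1$ is used. *)

theory Defs
  imports
    "HOL-Analysis.Analysis"
    "HOL-Computational_Algebra.Formal_Power_Series"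
begin

definition leibnitz :: "nat \<Rightarrow> nat \<Rightarrow> 'a :: field_char_0" where
  "leibnitz n k = 1 / (of_nat (n + 1) * of_nat (n choose k))"

text \<open>The Daehee numbers have the exponential generating function \<open>log (1 + u) / u\<close>, and
  \<open>fps_ln 1\<close> is the library's formal power series of \<open>log (1 + u)\<close>.\<close>

definition daehee :: "nat \<Rightarrow> 'a :: field_char_0" where
  "daehee n = fact n * fps_nth (fps_ln 1 / fps_X) n"

lemma daehee_egf:
  "fps_ln 1 / fps_X = Abs_fps (\<lambda>n. daehee n / fact n :: 'a :: field_char_0)"
  by (simp add: fps_eq_iff daehee_def)

lemma daehee_explicit:
  "(daehee n :: 'a :: field_char_0) = (-1) ^ n * fact n / of_nat (n + 1)"
  by (simp add: daehee_def fps_ln_def)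

end

theory Submission
  imports Defs
begin

text \<open>In Leibniz's harmonic triangle every entry is the sum of the two entries below it. Hence the
  left-hand sum \<open>S n\<close> satisfies \<open>(1 + t) * S (n + 1) = t * S n + (1 + t ^ (n + 2)) / (n + 2)\<close>.
  Since \<open>(-1) ^ j * D j / j! = 1 / (j + 1)\<close>, the right-hand side is the solution of this recurrence
  obtained by unrolling it.\<close>

lemma leibnitz_0 [simp]: "leibnitz n 0 = 1 / of_nat (n + 1)"
  by (simp add: leibnitz_def)

lemma leibnitz_self [simp]: "leibnitz n n = 1 / of_nat (n + 1)"
  by (simp add: leibnitz_def)

text \<open>With \<open>c = (n + 1) * (n choose k)\<close>, the two absorption identities write
  \<open>c\<close> as a multiple of each binomial in row \<open>n + 1\<close>. Both entries thus get
  the denominator \<open>(n + 2) * c\<close>, and their numerators \<open>n + 1 - k\<close> and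
  \<open>k + 1\<close> add up to \<open>n + 2\<close>.\<close>

lemma leibnitz_triangle:
  assumes "k \<le> n"
  shows "leibnitz (Suc n) k + leibnitz (Suc n) (Suc k) = (leibnitz n k :: 'a :: field_char_0)"
proof -
  define c where "c = (of_nat (Suc n * (n choose k)) :: 'a)"
  have nz: "c \<noteq> 0" "(of_nat (n + 2) :: 'a) \<noteq> 0"
    using assms by (simp_all add: c_def del: of_nat_Suc of_nat_mult of_nat_add)
  have "(Suc n - k) * (Suc n choose k) = Suc n * (n choose k)"
    using binomial_absorb_comp[of "Suc n" k] by simp
  then have 1: "of_nat (Suc n - k) * of_nat (Suc n choose k) = c"
    unfolding c_def by (metis of_nat_mult)
  have 2: "of_nat (Suc k) * of_nat (Suc n choose Suc k) = c"
    unfolding c_def by (metis Suc_times_binomial_eq of_nat_mult mult.commute)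
  \<comment> \<open>Here \<open>a * b = c\<close> with \<open>c\<close> nonzero forces
    \<open>a\<close> and \<open>b\<close> to be nonzero; for \<open>m = 0\<close> both sides are
    0.\<close>
  have div: "1 / (m * b) = a / (m * c)" if "a * b = c" for a b m :: 'a
    using nz(1) that by auto
  have "leibnitz (Suc n) k = of_nat (Suc n - k) / (of_nat (n + 2) * c)"
    unfolding leibnitz_def using div[OF 1] by simp
  moreover have "leibnitz (Suc n) (Suc k) = of_nat (Suc k) / (of_nat (n + 2) * c)"
    unfolding leibnitz_def using div[OF 2] by simp
  moreover have "(of_nat (Suc n - k) + of_nat (Suc k) :: 'a) = of_nat (n + 2)"
    using assms by (simp flip: of_nat_add)
  ultimately have "leibnitz (Suc n) k + leibnitz (Suc n) (Suc k) = of_nat (n + 2) / (of_nat (n + 2) * c)"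
    by (metis add_divide_distrib)
  also have "\<dots> = 1 / c"
    using nz(2) by (simp del: of_nat_add)
  also have "1 / c = leibnitz n k"
    by (simp add: leibnitz_def c_def distrib_right)
  finally show ?thesis .
qed

text \<open>Split the first term off the sum and the last term off \<open>t\<close> times the sum.
  What remains of both carries \<open>t ^ Suc k\<close> and pairs up by
  \<open>leibnitz_triangle\<close>; the two border entries, both \<open>1 / (n + 2)\<close>, form
  the inhomogeneous term.\<close>

lemma sum_leibnitz_Suc:
  fixes t :: "'a :: field_char_0"
  shows "(1 + t) * (\<Sum>k=0..Suc n. leibnitz (Suc n) k * t ^ k) =
    t * (\<Sum>k=0..n. leibnitz n k * t ^ k) + (1 + t ^ (n + 2)) / of_nat (n + 2)"
proof -
  let ?l = "leibnitz (Suc n) :: nat \<Rightarrow> 'a"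
  have "(\<Sum>k=0..Suc n. ?l k * t ^ k) = ?l 0 + (\<Sum>k=0..n. ?l (Suc k) * t ^ Suc k)"
    by (subst sum.atLeast0_atMost_Suc_shift) (simp del: leibnitz_0)
  moreover have "t * (\<Sum>k=0..Suc n. ?l k * t ^ k) =
      (\<Sum>k=0..n. ?l k * t ^ Suc k) + ?l (Suc n) * t ^ (n + 2)"
    by (simp add: sum_distrib_left algebra_simps del: leibnitz_self)
  ultimately have "(1 + t) * (\<Sum>k=0..Suc n. ?l k * t ^ k) =
      (\<Sum>k=0..n. (?l k + ?l (Suc k)) * t ^ Suc k) + (?l 0 + ?l (Suc n) * t ^ (n + 2))"
    by (simp only: distrib_right mult_1 sum.distrib) (simp only: ac_simps)
  also have "(\<Sum>k=0..n. (?l k + ?l (Suc k)) * t ^ Suc k) = t * (\<Sum>k=0..n. leibnitz n k * t ^ k)"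
    unfolding sum_distrib_left by (intro sum.cong refl) (simp add: leibnitz_triangle)
  also have "?l 0 + ?l (Suc n) * t ^ (n + 2) = (1 + t ^ (n + 2)) / of_nat (n + 2)"
    by (simp add: add_divide_distrib)
  finally show ?thesis .
qed

text \<open>Each step of the recurrence multiplies the earlier terms by \<open>t / (1 + t)\<close>,
  so \<open>n - j\<close> counts the steps since term \<open>j\<close> entered.\<close>

lemma sum_leibnitz:
  fixes t :: "'a :: field_char_0"
  assumes "t \<noteq> -1"
  shows "(\<Sum>k=0..n. leibnitz n k * t ^ k) =
    1 / (1 + t) * (\<Sum>j=0..n. (t / (1 + t)) ^ (n - j) * ((1 + t ^ (j + 1)) / of_nat (j + 1)))"
proof (induction n)
  have nz: "1 + t \<noteq> 0"
    using assms by (simp add: add_eq_0_iff)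
  {
    case 0
    then show ?case
      using nz by simp
  next
    case (Suc n)
    let ?r = "t / (1 + t)" and ?c = "\<lambda>j. (1 + t ^ (j + 1)) / of_nat (j + 1) :: 'a"
    have "(\<Sum>k=0..Suc n. leibnitz (Suc n) k * t ^ k) =
        1 / (1 + t) * (t * (\<Sum>k=0..n. leibnitz n k * t ^ k) + ?c (Suc n))"
      using sum_leibnitz_Suc[of t n] nz by (simp add: eq_divide_eq mult.commute)
    also have "\<dots> = 1 / (1 + t) * (?r * (\<Sum>j=0..n. ?r ^ (n - j) * ?c j) + ?c (Suc n))"
      unfolding Suc.IH by simp
    \<comment> \<open>The exponent rises by one because \<open>j\<close> \<le> \<open>n\<close>, so
      the subtraction is not truncated. The new term \<open>j = Suc n\<close> then fits with
      exponent 0, also for \<open>t = 0\<close>.\<close>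
    also have "?r * (\<Sum>j=0..n. ?r ^ (n - j) * ?c j) = (\<Sum>j=0..n. ?r ^ (Suc n - j) * ?c j)"
      unfolding sum_distrib_left by (intro sum.cong refl) (simp add: Suc_diff_le)
    finally show ?case
      by simp
  }
qed

theorem theorem2p3:
  fixes n :: nat and t :: complex
  assumes "t \<noteq> -1"
  shows "(\<Sum>k=0..n. leibnitz n k * t ^ k) =
    1 / (1 + t) * (\<Sum>j=0..n. (-1) ^ j * (daehee j / fact j) * (t / (1 + t)) ^ (n - j) * (1 + t ^ (j + 1)))"
proof -
  \<comment> \<open>The two signs merge into \<open>((-1) * (-1)) ^ j = 1\<close>, and the
    factorials cancel.\<close>
  have "(-1) ^ j * (daehee j / fact j) = (1 / of_nat (j + 1) :: complex)" for j
    by (simp add: daehee_explicit flip: power_mult_distrib)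
  then show ?thesis
    unfolding sum_leibnitz[OF assms] by (simp add: mult.commute)
qed

end
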